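(* Assume that there are constants $\gamma\ge 0$ and $\omega'\in[0,\omega)$ such that $$M b^2 e^{\omega\tau}\int_0^t |k(s+\tau)|\,ds\le \gamma+\omega' t\qquad\text{for all } t>0 .$$ Moreover, suppose that the following well-posedness assumption holds: there exist $\rho>0$ and $C_\rho>0$, with $L(C_\rho)<\frac{\omega-\omega'}{M}$, such that if $U_0\in\mathcal H$ and $f\in C([-\tau,0];\mathcal H)$ satisfy $$\|U_0\|_{\mathcal H}^2+\int_0^\tau |k(s)|\,\|f(s-\tau)\|_{\mathcal H}^2\,ds<\rho^2, \qquad (\ast)$$ then the system $$U'(t)=\mathcal A U(t)-k(t)\mathcal B U(t-\tau)+F(U(t)),\quad U(0)=U_0,\quad \mathcal B U(t)=f(t)\ \text{ for } t\in[-\tau,0], \qquad (\mathrm{S})$$ has a unique solution $U\in C([0,+\infty);\mathcal H)$ satisfying $\|U(t)\|_{\mathcal H}\le C_\rho$ for all $t>0$. Then, for every solution $U$ of $(\mathrm{S})$ with initial data $(U_0,f)$ satisfying $(\ast)$, $$\|U(t)\|_{\mathcal H}\le M e^{\gamma}\left(\|U_0\|_{\mathcal H}+\int_0^\tau e^{\omega s}|k(s)|\,\|f(s-\tau)\|_{\mathcal H}\,ds\right)e^{-(\omega-\omega'-ML(C_\rho))t}\qquad\text{for all } t\ge 0 .$$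
   Context: Setting. $H$ is a Hilbert space and $A:\mathcal D(A)\subset H\to H$ is a positive self-adjoint operator with dense domain and compact inverse. $W_1,W_2$ are real Hilbert spaces identified with their duals, and $C:W_1\to H$, $B:W_2\to H$ are bounded linear operators with adjoints $C^*,B^*$; $b:=\|B\|=\|B^*\|$ (operator norm). $\tau>0$ is a fixed delay. $k\in L^1_{loc}([0,+\infty))$ is real-valued, and there is $K>0$ with $\int_{t-\tau}^t|k(s)|\,ds\le K$ for all $t\ge 0$ (only the part of the interval lying in $[0,+\infty)$ is counted). Nonlinearity. $\psi:\mathcal D(A^{1/2})\to\mathbb R$ has a Gâteaux derivative $D\psi(u)$ at every $u\in\mathcal D(A^{1/2})$ and satisfies: (H1) for every $u\in\mathcal D(A^{1/2})$ there is $c(u)>0$ with $|D\psi(u)(v)|\le c(u)\|v\|_H$ for all $v\in\mathcal D(A^{1/2})$; hence $D\psi(u)$ extends to a bounded functional on $H$, and $\nabla\psi(u)\in H$ denotes its Riesz representative, $\langle\nabla\psi(u),v\rangle_H=D\psi(u)(v)$; (H2) for every $r>0$ there is $L(r)>0$ with $\|\nabla\psi(u)-\nabla\psi(v)\|_H\le L(r)\|A^{1/2}(u-v)\|_H$ whenever $\|A^{1/2}u\|_H\le r$ and $\|A^{1/2}v\|_H\le r$; (H3) $\psi(0)=0$, $\nabla\psi(0)=0$, and there is a strictly increasing continuous function $h$ on $[0,+\infty)$ with $\|\nabla\psi(u)\|_H\le h(\|A^{1/2}u\|_H)\|A^{1/2}u\|_H$ for all $u\in\mathcal D(A^{1/2})$.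 Abstract form. $\mathcal H=\mathcal D(A^{1/2})\times H$ with inner product $\langle(u,v),(\tilde u,\tilde v)\rangle_{\mathcal H}=\langle A^{1/2}u,A^{1/2}\tilde u\rangle_H+\langle v,\tilde v\rangle_H$. For $U=(u,v)$, $$\mathcal A U=(v,\,-Au-CC^*v),\qquad \mathcal B U=(0,\,BB^*v),\qquad F(U)=(0,\nabla\psi(u)).$$ It is assumed that the damping operator $CC^*$ is such that $\mathcal A$ generates an exponentially stable $C_0$-semigroup $\{S(t)\}_{t\ge0}$ on $\mathcal H$: there are $M,\omega>0$ with $\|S(t)\|_{\mathcal L(\mathcal H)}\le M e^{-\omega t}$ for all $t\ge0$. These $M,\omega$ are fixed. One has $F(0)=0$, $\|\mathcal B\|_{\mathcal L(\mathcal H)}=b^2$, and, with the same function $L(\cdot)$ as in (H2), $\|F(U)-F(V)\|_{\mathcal H}\le L(r)\|U-V\|_{\mathcal H}$ whenever $\|U\|_{\mathcal H},\|V\|_{\mathcal H}\le r$. Solutions of the system are understood in the mild sense (Duhamel's formula): $U(t)=S(t)U_0+\int_0^t S(t-s)\,[-k(s)\mathcal B U(s-\tau)+F(U(s))]\,ds$, where $\mathcal B U(s-\tau)$ means $f(s-\tau)$ for $s\in[0,\tau]$. *)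

theory Defs
  imports "HOL-Analysis.Analysis"
begin

text \<open>
  An unbounded operator is a pair of a domain \<open>D\<close> and a total function, whose values outside \<open>D\<close>
  are never used.
\<close>

definition linear_operator :: "'h::real_inner set \<Rightarrow> ('h \<Rightarrow> 'h) \<Rightarrow> bool" where
  "linear_operator D A \<longleftrightarrow> subspace D \<and>
     (\<forall>x\<in>D. \<forall>y\<in>D. A (x + y) = A x + A y) \<and> (\<forall>c. \<forall>x\<in>D. A (c *\<^sub>R x) = c *\<^sub>R A x)"

text \<open>
  The last conjunct says that the adjoint of \<open>A\<close>, whose graph consists of the pairs \<open>(y, z)\<close> with
  \<open>\<langle>A x, y\<rangle> = \<langle>x, z\<rangle>\<close> for all \<open>x\<close> in the domain, coincides with \<open>A\<close>, domains included.
\<close>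

definition self_adjoint_operator :: "'h::real_inner set \<Rightarrow> ('h \<Rightarrow> 'h) \<Rightarrow> bool" where
  "self_adjoint_operator D A \<longleftrightarrow> linear_operator D A \<and> closure D = UNIV \<and>
     (\<forall>y z. (\<forall>x\<in>D. inner (A x) y = inner x z) \<longleftrightarrow> y \<in> D \<and> A y = z)"

definition positive_operator :: "'h::real_inner set \<Rightarrow> ('h \<Rightarrow> 'h) \<Rightarrow> bool" where
  "positive_operator D A \<longleftrightarrow> (\<forall>x\<in>D. x \<noteq> 0 \<longrightarrow> 0 < inner (A x) x)"

definition compact_inverse :: "'h::real_inner set \<Rightarrow> ('h \<Rightarrow> 'h) \<Rightarrow> bool" where
  "compact_inverse D A \<longleftrightarrow> bij_betw A D UNIV \<and>
     (\<forall>X. bounded X \<longrightarrow> compact (closure (inv_into D A ` X)))"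

text \<open>
  \<open>(D', R)\<close> is the square root of \<open>(D, A)\<close>: the (unique) self-adjoint operator with nonnegative
  quadratic form such that \<open>R\<^sup>2 = A\<close> with equality of domains.
\<close>

definition operator_sqrt ::
    "'h::real_inner set \<Rightarrow> ('h \<Rightarrow> 'h) \<Rightarrow> 'h set \<Rightarrow> ('h \<Rightarrow> 'h) \<Rightarrow> bool" where
  "operator_sqrt D A D' R \<longleftrightarrow> self_adjoint_operator D' R \<and> (\<forall>x\<in>D'. 0 \<le> inner (R x) x) \<and>
     D = {x \<in> D'. R x \<in> D'} \<and> (\<forall>x\<in>D. R (R x) = A x)"

text \<open>
  The type \<open>'v\<close>, with the embedding \<open>\<iota>\<close> into \<open>H\<close>, is the domain \<open>D'\<close> of \<open>R\<close> (here \<open>R\<close> is the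
  square root of \<open>A\<close>) equipped with the inner product \<open>\<langle>R u, R v\<rangle>\<close>. Since \<open>R\<close> is a bijection from
  \<open>D'\<close> onto \<open>H\<close>, such a realisation always exists: take \<open>'v\<close> to be the type of \<open>H\<close> and \<open>\<iota>\<close> the
  inverse of \<open>R\<close>. The inner product and norm of the library on \<open>'v \<times> 'h\<close> are then those of the
  energy space, with norm \<open>(\<parallel>R u\<parallel>\<^sup>2 + \<parallel>v\<parallel>\<^sup>2)\<^sup>1\<^sup>/\<^sup>2\<close>.
\<close>

definition sqrt_domain_space ::
    "'h::real_inner set \<Rightarrow> ('h \<Rightarrow> 'h) \<Rightarrow> ('v::real_inner \<Rightarrow> 'h) \<Rightarrow> bool" where
  "sqrt_domain_space D' R \<iota> \<longleftrightarrow> linear \<iota> \<and> bij_betw \<iota> UNIV D' \<and>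
     (\<forall>u v. inner u v = inner (R (\<iota> u)) (R (\<iota> v)))"

definition has_gateaux_derivative ::
    "('v::real_normed_vector \<Rightarrow> real) \<Rightarrow> ('v \<Rightarrow> real) \<Rightarrow> 'v \<Rightarrow> bool" where
  "has_gateaux_derivative \<psi> D u \<longleftrightarrow> bounded_linear D \<and>
     (\<forall>v. ((\<lambda>\<epsilon>. (\<psi> (u + \<epsilon> *\<^sub>R v) - \<psi> u) / \<epsilon>) \<longlongrightarrow> D v) (at 0))"

definition C0_semigroup :: "(real \<Rightarrow> 'a::real_normed_vector \<Rightarrow>\<^sub>L 'a) \<Rightarrow> bool" where
  "C0_semigroup S \<longleftrightarrow> S 0 = id_blinfun \<and>
     (\<forall>s\<ge>0. \<forall>t\<ge>0. S (s + t) = S s o\<^sub>L S t) \<and>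
     (\<forall>x. ((\<lambda>t. blinfun_apply (S t) x) \<longlongrightarrow> x) (at_right 0))"

definition infinitesimal_generator ::
    "'a::real_normed_vector set \<Rightarrow> ('a \<Rightarrow> 'a) \<Rightarrow> (real \<Rightarrow> 'a \<Rightarrow>\<^sub>L 'a) \<Rightarrow> bool" where
  "infinitesimal_generator D G S \<longleftrightarrow>
     (\<forall>x y. ((\<lambda>t. (1 / t) *\<^sub>R (blinfun_apply (S t) x - x)) \<longlongrightarrow> y) (at_right 0)
        \<longleftrightarrow> x \<in> D \<and> G x = y)"

text \<open>
  The operator \<open>(u, v) \<mapsto> (v, - A u - C C\<^sup>* v)\<close>. Its first component must lie in the domain of
  the square root of \<open>A\<close>, so \<open>v\<close> ranges over that domain, which is the range of \<open>\<iota>\<close>.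
\<close>

definition wave_domain :: "'h set \<Rightarrow> ('v \<Rightarrow> 'h) \<Rightarrow> ('v \<times> 'h) set" where
  "wave_domain D \<iota> = {(u, v). \<iota> u \<in> D \<and> v \<in> range \<iota>}"

definition wave_operator ::
    "('h \<Rightarrow> 'h) \<Rightarrow> ('w::real_inner \<Rightarrow>\<^sub>L 'h::real_inner) \<Rightarrow> ('v \<Rightarrow> 'h) \<Rightarrow> 'v \<times> 'h \<Rightarrow> 'v \<times> 'h" where
  "wave_operator A C \<iota> = (\<lambda>(u, v).
     (inv \<iota> v, - A (\<iota> u) - blinfun_apply C (adjoint (blinfun_apply C) v)))"

definition delay_operator ::
    "('w::real_inner \<Rightarrow>\<^sub>L 'h::real_inner) \<Rightarrow> 'v::zero \<times> 'h \<Rightarrow> 'v \<times> 'h" where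
  "delay_operator B = (\<lambda>(u, v). (0, blinfun_apply B (adjoint (blinfun_apply B) v)))"

definition source_term :: "('v \<Rightarrow> 'h) \<Rightarrow> 'v::zero \<times> 'h \<Rightarrow> 'v \<times> 'h" where
  "source_term G = (\<lambda>(u, v). (0, G u))"

text \<open>
  Mild solutions on \<open>[0, \<infinity>)\<close> of \<open>U' = A U - k(t) P U(t - \<tau>) + F(U)\<close>, \<open>U(0) = U0\<close>, where \<open>A\<close>
  generates \<open>S\<close> and \<open>f\<close> prescribes \<open>P U\<close> on \<open>[-\<tau>, 0]\<close>; no compatibility of \<open>f(0)\<close> with \<open>P U0\<close> is
  imposed. Values of \<open>U\<close> at negative times are irrelevant.
\<close>

definition duhamel_integrand ::
    "(real \<Rightarrow> 'a::real_normed_vector \<Rightarrow>\<^sub>L 'a) \<Rightarrow> real \<Rightarrow> (real \<Rightarrow> real) \<Rightarrow> ('a \<Rightarrow> 'a) \<Rightarrow> ('a \<Rightarrow> 'a) \<Rightarrow>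
     (real \<Rightarrow> 'a) \<Rightarrow> (real \<Rightarrow> 'a) \<Rightarrow> real \<Rightarrow> real \<Rightarrow> 'a" where
  "duhamel_integrand S \<tau> k P F f U t s =
     blinfun_apply (S (t - s))
       (- (k s *\<^sub>R (if s \<le> \<tau> then f (s - \<tau>) else P (U (s - \<tau>)))) + F (U s))"

definition mild_solution ::
    "(real \<Rightarrow> 'a::{banach, second_countable_topology} \<Rightarrow>\<^sub>L 'a) \<Rightarrow> real \<Rightarrow> (real \<Rightarrow> real) \<Rightarrow>
     ('a \<Rightarrow> 'a) \<Rightarrow> ('a \<Rightarrow> 'a) \<Rightarrow> 'a \<Rightarrow> (real \<Rightarrow> 'a) \<Rightarrow> (real \<Rightarrow> 'a) \<Rightarrow> bool" where
  "mild_solution S \<tau> k P F U0 f U \<longleftrightarrow> continuous_on {0..} U \<and>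
     (\<forall>t\<ge>0. set_integrable lebesgue {0..t} (duhamel_integrand S \<tau> k P F f U t) \<and>
        U t = blinfun_apply (S t) U0 +
              (LINT s:{0..t}|lebesgue. duhamel_integrand S \<tau> k P F f U t s))"

definition admissible_data ::
    "real \<Rightarrow> (real \<Rightarrow> real) \<Rightarrow> real \<Rightarrow> 'a::real_normed_vector \<Rightarrow> (real \<Rightarrow> 'a) \<Rightarrow> bool" where
  "admissible_data \<tau> k \<rho> U0 f \<longleftrightarrow> continuous_on {-\<tau>..0} f \<and>
     (norm U0)\<^sup>2 + (LINT s:{0..\<tau>}|lebesgue. \<bar>k s\<bar> * (norm (f (s - \<tau>)))\<^sup>2) < \<rho>\<^sup>2"

end

theory Submission
  imports Defs
begin

text \<open>
  Duhamel's formula, multiplied by \<open>e\<^bsup>\<omega>t\<^esup>\<close> and with the delayed part shifted by \<open>\<tau>\<close>, bounds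
  \<open>w(t) = e\<^bsup>\<omega>t\<^esup> \<parallel>U(t)\<parallel>\<close> by a constant plus \<open>\<integral>\<^sub>0\<^sup>t \<beta> w\<close> with
  \<open>\<beta>(s) = M b\<^sup>2 e\<^bsup>\<omega>\<tau>\<^esup> \<bar>k(s + \<tau>)\<bar> + M L\<close>, and Gronwall's inequality gives the decay.
  The well-posedness assumption only bounds one mild solution by \<open>C\<rho>\<close> and asserts uniqueness among
  the bounded ones. The same estimate, applied to a difference of two mild solutions (zero data, and
  \<open>L\<close> taken at a radius containing both on \<open>[0, T]\<close>), gives uniqueness without any bound.
\<close>

section \<open>Gronwall inequalities with an integrable kernel and with a delay\<close>

text \<open>
  As \<open>\<beta>\<close> is only integrable, \<open>m(t) = a + \<integral>\<^sub>0\<^sup>t \<beta> w\<close> is not differentiated: from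
  \<open>m(t) (1 - \<integral>\<^sub>s\<^sup>t \<beta>) \<le> m(s)\<close>, used on \<open>n\<close> intervals carrying equal mass of \<open>\<beta>\<close>, one gets
  \<open>m(T) (1 - b/n)\<^sup>n \<le> a\<close> with \<open>b = \<integral>\<^sub>0\<^sup>T \<beta>\<close>, and \<open>n \<rightarrow> \<infinity>\<close>.
\<close>

lemma gronwall_integrable_kernel:
  fixes \<beta> w :: "real \<Rightarrow> real"
  assumes T: "0 \<le> T"
    and \<beta>: "\<beta> absolutely_integrable_on {0..T}" "\<And>s. s \<in> {0..T} \<Longrightarrow> 0 \<le> \<beta> s"
    and w: "continuous_on {0..T} w" "\<And>s. s \<in> {0..T} \<Longrightarrow> 0 \<le> w s"
    and le: "\<And>t. t \<in> {0..T} \<Longrightarrow> w t \<le> a + integral {0..t} (\<lambda>s. \<beta> s * w s)"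
  shows "w T \<le> a * exp (integral {0..T} \<beta>)"
proof -
  define m where "m t = a + integral {0..t} (\<lambda>s. \<beta> s * w s)" for t
  define b where "b t = integral {0..t} \<beta>" for t
  \<comment> \<open>A continuous function on a compact interval is bounded and measurable, so its
    product with the merely integrable \<open>\<beta>\<close> stays integrable.\<close>
  have "(\<lambda>s. w s * \<beta> s) absolutely_integrable_on {0..T}"
  proof (rule absolutely_integrable_bounded_measurable_product_real[OF _ _ _ \<beta>(1)])
    show "w \<in> borel_measurable (lebesgue_on {0..T})"
      using w(1) by (intro continuous_imp_measurable_on_sets_lebesgue) auto
    show "bounded (w ` {0..T})"
      using w(1) by (intro compact_imp_bounded compact_continuous_image) auto
  qed auto
  then have bw: "(\<lambda>s. \<beta> s * w s) integrable_on {0..T}"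
    by (simp add: mult.commute set_lebesgue_integral_eq_integral(1))
  have b: "\<beta> integrable_on {0..T}"
    using \<beta>(1) by (simp add: set_lebesgue_integral_eq_integral(1))
  have sub: "f integrable_on {s..t}" if "f integrable_on {0..T}" "0 \<le> s" "t \<le> T"
    for f :: "real \<Rightarrow> real" and s t
    using that by (auto intro: integrable_subinterval_real)
  have m_diff: "m t - m s = integral {s..t} (\<lambda>s. \<beta> s * w s)"
    and b_diff: "b t - b s = integral {s..t} \<beta>" if "0 \<le> s" "s \<le> t" "t \<le> T" for s t
    using that Henstock_Kurzweil_Integration.integral_combine[OF that(1,2) sub[OF bw order_refl that(3)]]
      Henstock_Kurzweil_Integration.integral_combine[OF that(1,2) sub[OF b order_refl that(3)]]
    by (auto simp: m_def b_def)
  have m_mono: "m s \<le> m t" if "0 \<le> s" "s \<le> t" "t \<le> T" for s t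
  proof -
    have "0 \<le> integral {s..t} (\<lambda>s. \<beta> s * w s)"
      using that \<beta>(2) w(2) by (intro integral_nonneg sub[OF bw]) auto
    with m_diff[OF that] show ?thesis by simp
  qed
  \<comment> \<open>On \<open>{s..t}\<close> the hypothesis and the monotonicity of \<open>m\<close>
    give \<open>w r \<le> m r \<le> m t\<close>, so the increment of \<open>m\<close> is at most
    \<open>m t\<close> times the mass of \<open>\<beta>\<close> there.\<close>
  have step: "m t * (1 - (b t - b s)) \<le> m s" if "0 \<le> s" "s \<le> t" "t \<le> T" for s t
  proof -
    have "m t - m s \<le> integral {s..t} (\<lambda>r. \<beta> r * m t)"
      unfolding m_diff[OF that]
    proof (intro integral_le sub[OF bw] integrable_on_mult_left sub[OF b])
      fix r assume r: "r \<in> {s..t}"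
      then have "w r \<le> m t"
        using that le[of r] m_mono[of r t] by (auto simp: m_def)
      then show "\<beta> r * w r \<le> \<beta> r * m t"
        using \<beta>(2)[of r] r that by (intro mult_left_mono) auto
    qed (use that in auto)
    then show ?thesis
      by (simp add: b_diff[OF that] algebra_simps)
  qed
  have m0: "m 0 = a" and b0: "b 0 = 0" by (simp_all add: m_def b_def)
  have b_cont: "continuous_on {0..T} b"
    unfolding b_def by (rule indefinite_integral_continuous_1[OF b])
  have bT: "0 \<le> b T"
    unfolding b_def using \<beta>(2) by (intro integral_nonneg b) auto
  have iter: "m T * (1 - b T / real n) ^ n \<le> a" if n: "b T < real n" for n
  proof -
    have npos: "0 < real n" using n bT by linarith
    define \<delta> where "\<delta> = b T / real n"
    \<comment> \<open>The choice \<open>b T < real n\<close> makes \<open>1 - \<delta>\<close>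
      positive, so inequalities survive multiplication by its powers.\<close>
    have \<delta>: "0 \<le> \<delta>" "\<delta> < 1" using npos n bT by (auto simp: \<delta>_def)
    have "\<exists>s\<in>{0..T}. b s = real i * \<delta> \<and> m s * (1 - \<delta>) ^ i \<le> a" if "i \<le> n" for i
      using that
    proof (induction i)
      case 0
      then show ?case using T m0 b0 by (intro bexI[of _ 0]) auto
    next
      case (Suc i)
      then obtain s where s: "s \<in> {0..T}" "b s = real i * \<delta>" "m s * (1 - \<delta>) ^ i \<le> a" by auto
      \<comment> \<open>The next level must not exceed \<open>b T\<close>, so that the intermediate
        value theorem finds a point of \<open>{s..T}\<close> where \<open>b\<close> attains
        it.\<close>
      have "real (Suc i) * \<delta> \<le> real n * \<delta>"
        using Suc.prems \<delta> by (intro mult_right_mono) auto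
      also have "\<dots> = b T" using npos by (simp add: \<delta>_def)
      finally have "\<exists>t\<ge>s. t \<le> T \<and> b t = real (Suc i) * \<delta>"
        using s \<delta> by (intro IVT') (auto intro: continuous_on_subset[OF b_cont] simp: algebra_simps)
      then obtain t where t: "s \<le> t" "t \<le> T" "b t = real (Suc i) * \<delta>" by blast
      have "m t * (1 - \<delta>) \<le> m s"
        using step[of s t] s t by (simp add: algebra_simps)
      then have "m t * (1 - \<delta>) * (1 - \<delta>) ^ i \<le> m s * (1 - \<delta>) ^ i"
        using \<delta> by (intro mult_right_mono) auto
      then show ?case using s t by (intro bexI[of _ t]) (auto simp: mult_ac)
    qed
    then obtain s where s: "s \<in> {0..T}" "b s = real n * \<delta>" "m s * (1 - \<delta>) ^ n \<le> a" by blast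
    \<comment> \<open>The last division point need not be \<open>T\<close>, as \<open>b\<close> may
      be constant near the end. But \<open>\<beta>\<close> has no mass on \<open>{s..T}\<close>, so
      \<open>step\<close> still gives \<open>m T \<le> m s\<close>.\<close>
    have "b s = b T" using s npos by (simp add: \<delta>_def)
    then have "m T \<le> m s" using step[of s T] s by simp
    then have "m T * (1 - \<delta>) ^ n \<le> m s * (1 - \<delta>) ^ n"
      using \<delta> by (intro mult_right_mono) auto
    with s show ?thesis by (simp add: \<delta>_def)
  qed
  have "(\<lambda>n. m T * (1 + (- b T) / real n) ^ n) \<longlonglongrightarrow> m T * exp (- b T)"
    by (intro tendsto_intros tendsto_exp_limit_sequentially)
  moreover have "eventually (\<lambda>n. m T * (1 + (- b T) / real n) ^ n \<le> a) sequentially"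
    using eventually_gt_at_top[of "nat \<lceil>b T\<rceil>"]
  proof eventually_elim
    case (elim n)
    then have "b T < real n" by linarith
    from iter[OF this] show ?case by simp
  qed
  ultimately have "m T * exp (- b T) \<le> a"
    by (rule tendsto_upperbound) simp
  moreover have "w T \<le> m T" using le[of T] T by (simp add: m_def)
  ultimately show ?thesis
    by (simp add: exp_minus b_def field_simps)
qed

text \<open>Scalar core shared by the decay estimate and the uniqueness proof. The function
  \<open>g\<close> will be the norm of the Duhamel integrand, whose integrability is part of being a
  mild solution. The inequality is asked only up to the fixed \<open>T\<close>, so \<open>l\<close>
  may be a Lipschitz constant on a ball containing the solution on \<open>{0..T}\<close>.\<close>

lemma delay_gronwall:
  fixes k y \<phi> :: "real \<Rightarrow> real"
  assumes \<tau>: "0 \<le> \<tau>" and M: "0 \<le> M" and p: "0 \<le> p" and l: "0 \<le> l"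
    and k: "\<And>T. 0 \<le> T \<Longrightarrow> k absolutely_integrable_on {0..T}"
    and y: "continuous_on {0..} y" "\<And>s. 0 \<le> s \<Longrightarrow> 0 \<le> y s"
    and \<phi>: "continuous_on {0..\<tau>} \<phi>" "\<And>s. s \<in> {0..\<tau>} \<Longrightarrow> 0 \<le> \<phi> s"
    and duhamel: "\<And>t. 0 \<le> t \<Longrightarrow> t \<le> T \<Longrightarrow> \<exists>g. g integrable_on {0..t} \<and>
        y t \<le> exp (- \<omega> * t) * a + integral {0..t} g \<and>
        (\<forall>s\<in>{0..t}. g s \<le> M * exp (- \<omega> * (t - s)) *
          (\<bar>k s\<bar> * (if s \<le> \<tau> then \<phi> s else p * y (s - \<tau>)) + l * y s))"
    and T: "0 \<le> T"
  shows "y T \<le> (a + M * (LINT s:{0..\<tau>}|lebesgue. exp (\<omega> * s) * \<bar>k s\<bar> * \<phi> s)) *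
      exp (M * p * exp (\<omega> * \<tau>) * (LINT s:{0..T}|lebesgue. \<bar>k (s + \<tau>)\<bar>) + M * l * T) * exp (- \<omega> * T)"
proof -
  define G where "G s = exp (\<omega> * s) * \<bar>k s\<bar> * \<phi> s" for s
  define H where "H s = exp (\<omega> * s) * \<bar>k s\<bar> * (p * y (s - \<tau>))" for s
  define w where "w s = exp (\<omega> * s) * y s" for s
  define \<beta> where "\<beta> s = M * p * exp (\<omega> * \<tau>) * \<bar>k (s + \<tau>)\<bar> + M * l" for s
  \<comment> \<open>Empty intervals are allowed because \<open>{\<tau>..t}\<close> occurs below also
    with \<open>t < \<tau>\<close>.\<close>
  have prod: "(\<lambda>s. q s * \<bar>k s\<bar>) absolutely_integrable_on {u..v}"
    if "continuous_on {u..v} q" "0 \<le> u" for q u v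
  proof (cases "u \<le> v")
    case True
    have "k absolutely_integrable_on {u..v}"
      using True that by (intro set_integrable_subset[OF k[of v]]) auto
    then have kuv: "(\<lambda>s. \<bar>k s\<bar>) absolutely_integrable_on {u..v}"
      using set_integrable_abs by blast
    show ?thesis
    proof (rule absolutely_integrable_bounded_measurable_product_real[OF _ _ _ kuv])
      show "q \<in> borel_measurable (lebesgue_on {u..v})"
        using that by (intro continuous_imp_measurable_on_sets_lebesgue) auto
      show "bounded (q ` {u..v})"
        using that by (intro compact_imp_bounded compact_continuous_image) auto
    qed auto
  qed (simp add: set_integrable_def)
  have G_abs: "G absolutely_integrable_on {0..\<tau>}"
  proof -
    have "(\<lambda>s. (exp (\<omega> * s) * \<phi> s) * \<bar>k s\<bar>) absolutely_integrable_on {0..\<tau>}"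
      by (intro prod continuous_intros \<phi>) auto
    then show ?thesis
      by (simp add: G_def[abs_def] mult_ac)
  qed
  note G_int = set_lebesgue_integral_eq_integral(1)[OF G_abs]
  have H_int: "H integrable_on {\<tau>..t}" for t
  proof -
    have "continuous_on {\<tau>..t} (\<lambda>s. y (s - \<tau>))"
      using y(1) by (rule continuous_on_compose2) (auto intro!: continuous_intros)
    then have "(\<lambda>s. (exp (\<omega> * s) * (p * y (s - \<tau>))) * \<bar>k s\<bar>) absolutely_integrable_on {\<tau>..t}"
      using \<tau> by (intro prod continuous_intros) auto
    then show ?thesis
      unfolding H_def by (auto dest: set_lebesgue_integral_eq_integral(1) simp: mult_ac)
  qed
  have G_nonneg: "0 \<le> G s" if "s \<in> {0..\<tau>}" for s
    using \<phi>(2)[OF that] by (simp add: G_def)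
  have H_nonneg: "0 \<le> H s" if "\<tau> \<le> s" for s
    using y(2)[of "s - \<tau>"] p that by (simp add: H_def)
  have w_cont: "continuous_on {0..t} w" for t
    unfolding w_def using continuous_on_subset[OF y(1), of "{0..t}"] by (intro continuous_intros) auto
  have w_nonneg: "0 \<le> w s" if "0 \<le> s" for s
    using y(2)[OF that] by (simp add: w_def)
  have kshift: "(\<lambda>s. \<bar>k (s + \<tau>)\<bar>) absolutely_integrable_on {0..t}" for t
  proof -
    have "(\<lambda>s. 1 * \<bar>k s\<bar>) absolutely_integrable_on {\<tau>..t + \<tau>}"
      by (rule prod) (use \<tau> in auto)
    then have "(\<lambda>s. \<bar>k s\<bar>) integrable_on {\<tau>..t + \<tau>}"
      by (auto dest: set_lebesgue_integral_eq_integral(1))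
    \<comment> \<open>The translation is done for the gauge integral; nonnegativity then gives back
      absolute integrability.\<close>
    from integrable_shift_real_ivl[OF this, of \<tau>] show ?thesis
      by (intro nonnegative_absolutely_integrable_1) auto
  qed
  have \<beta>_int: "\<beta> absolutely_integrable_on {0..t}" for t
    unfolding \<beta>_def by (intro set_integral_add set_integrable_mult_right kshift)
      (auto simp: absolutely_integrable_continuous_real)
  have Hshift: "(\<lambda>s. H (s + \<tau>)) integrable_on {0..t}" for t
    using integrable_shift_real_ivl[OF H_int[of "t + \<tau>"], of \<tau>] by simp
  define a' where "a' = a + M * integral {0..\<tau>} G"
  have key: "w t \<le> a' + integral {0..t} (\<lambda>s. \<beta> s * w s)" if t: "0 \<le> t" "t \<le> T" for t
  proof -
    obtain g where g: "g integrable_on {0..t}" "y t \<le> exp (- \<omega> * t) * a + integral {0..t} g"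
      "\<And>s. s \<in> {0..t} \<Longrightarrow> g s \<le> M * exp (- \<omega> * (t - s)) *
          (\<bar>k s\<bar> * (if s \<le> \<tau> then \<phi> s else p * y (s - \<tau>)) + l * y s)"
      using duhamel[OF t] by blast
    \<comment> \<open>Extension by zero puts the history and delayed parts on the common interval
      \<open>{0..t}\<close>, whether or not \<open>t\<close> exceeds \<open>\<tau>\<close>. At
      \<open>s = \<tau>\<close> both may be nonzero, which is harmless for an upper bound by
      nonnegative terms.\<close>
    define G' where "G' s = (if s \<in> {0..\<tau>} then G s else 0)" for s
    define H' where "H' s = (if s \<in> {\<tau>..t} then H s else 0)" for s
    have G'U: "G' integrable_on UNIV" "integral UNIV G' = integral {0..\<tau>} G"
      unfolding G'_def using G_int by (simp_all only: integrable_restrict_UNIV Henstock_Kurzweil_Integration.integral_restrict_UNIV)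
    have H'U: "H' integrable_on UNIV" "integral UNIV H' = integral {\<tau>..t} H"
      unfolding H'_def using H_int by (simp_all only: integrable_restrict_UNIV Henstock_Kurzweil_Integration.integral_restrict_UNIV)
    have G't: "G' integrable_on {0..t}" and H't: "H' integrable_on {0..t}"
      using G'U H'U by (auto intro: integrable_on_subinterval)
    have wt: "w integrable_on {0..t}" by (intro integrable_continuous_real w_cont)
    have "integral {0..t} g \<le> integral {0..t} (\<lambda>s. M * exp (- \<omega> * t) * (G' s + H' s + l * w s))"
    proof (intro integral_le g(1) integrable_on_mult_right integrable_add G't H't wt)
      fix s assume s: "s \<in> {0..t}"
      have "exp (\<omega> * s) * (\<bar>k s\<bar> * (if s \<le> \<tau> then \<phi> s else p * y (s - \<tau>)) + l * y s)
          \<le> G' s + H' s + l * w s"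
        using s G_nonneg[of s] H_nonneg[of s]
        by (auto simp: G'_def H'_def G_def[of s] H_def[of s] w_def algebra_simps)
      then have "M * exp (- \<omega> * t) * (exp (\<omega> * s) *
          (\<bar>k s\<bar> * (if s \<le> \<tau> then \<phi> s else p * y (s - \<tau>)) + l * y s))
          \<le> M * exp (- \<omega> * t) * (G' s + H' s + l * w s)"
        using M by (intro mult_left_mono) auto
      moreover have "exp (- \<omega> * (t - s)) = exp (- \<omega> * t) * exp (\<omega> * s)"
        by (simp add: exp_add[symmetric] algebra_simps)
      ultimately show "g s \<le> M * exp (- \<omega> * t) * (G' s + H' s + l * w s)"
        using g(3)[OF s] by (simp add: mult_ac)
    qed
    also have "\<dots> = M * exp (- \<omega> * t) * (integral {0..t} G' + integral {0..t} H' + l * integral {0..t} w)"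
      using G't H't wt by (simp add: integral_add integrable_add integrable_on_mult_right)
    also have "\<dots> \<le> M * exp (- \<omega> * t) *
        (integral {0..\<tau>} G + integral {0..t} (\<lambda>s. H (s + \<tau>)) + l * integral {0..t} w)"
    proof (intro mult_left_mono add_mono order_refl)
      show "integral {0..t} G' \<le> integral {0..\<tau>} G"
        unfolding G'U(2)[symmetric] using G'U G't G_nonneg
        by (intro integral_subset_le) (auto simp: G'_def)
      have "integral {0..t} H' \<le> integral {\<tau>..t} H"
        unfolding H'U(2)[symmetric] using H'U H't H_nonneg
        by (intro integral_subset_le) (auto simp: H'_def)
      also have "\<dots> = integral {0..t - \<tau>} (\<lambda>s. H (s + \<tau>))"
        using integral_shift_real_ivl[of \<tau> \<tau> t H] by simp
      \<comment> \<open>The shifted domain \<open>{0..t - \<tau>}\<close> is enlarged to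
        \<open>{0..t}\<close>, so that the delayed term becomes a Gronwall term over the same
        interval as the source term.\<close>
      also have "\<dots> \<le> integral {0..t} (\<lambda>s. H (s + \<tau>))"
        using H_nonneg \<tau> by (intro integral_subset_le Hshift) auto
      finally show "integral {0..t} H' \<le> integral {0..t} (\<lambda>s. H (s + \<tau>))" .
    qed (use M l in auto)
    finally have "exp (\<omega> * t) * y t \<le> exp (\<omega> * t) * (exp (- \<omega> * t) * a + M * exp (- \<omega> * t) *
        (integral {0..\<tau>} G + integral {0..t} (\<lambda>s. H (s + \<tau>)) + l * integral {0..t} w))"
      using g(2) by (intro mult_left_mono) auto
    also have "\<dots> = a' + M * (integral {0..t} (\<lambda>s. H (s + \<tau>)) + l * integral {0..t} w)"
      by (simp add: a'_def exp_minus field_simps)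
    also have "M * (integral {0..t} (\<lambda>s. H (s + \<tau>)) + l * integral {0..t} w) =
        integral {0..t} (\<lambda>s. M * (H (s + \<tau>) + l * w s))"
      using Hshift wt by (simp add: integral_add integrable_on_mult_right)
    \<comment> \<open>The weight \<open>exp (\<omega> * (s + \<tau>))\<close> splits:
      \<open>exp (\<omega> * \<tau>)\<close> goes into \<open>\<beta>\<close>, while
      \<open>exp (\<omega> * s) * y s\<close> is \<open>w s\<close>.\<close>
    also have "(\<lambda>s. M * (H (s + \<tau>) + l * w s)) = (\<lambda>s. \<beta> s * w s)"
      by (auto simp: H_def w_def \<beta>_def exp_add distrib_left distrib_right)
    finally show ?thesis by (simp add: w_def)
  qed
  have "w T \<le> a' * exp (integral {0..T} \<beta>)"
  proof (intro gronwall_integrable_kernel T \<beta>_int w_cont)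
    show "0 \<le> \<beta> s" for s
      using M p l by (simp add: \<beta>_def)
  qed (use w_nonneg key in auto)
  also have "integral {0..T} \<beta> = M * p * exp (\<omega> * \<tau>) * integral {0..T} (\<lambda>s. \<bar>k (s + \<tau>)\<bar>) + M * l * T"
    unfolding \<beta>_def using T set_lebesgue_integral_eq_integral(1)[OF kshift]
    by (subst integral_add) (auto intro: integrable_on_mult_right)
  also have "integral {0..T} (\<lambda>s. \<bar>k (s + \<tau>)\<bar>) = (LINT s:{0..T}|lebesgue. \<bar>k (s + \<tau>)\<bar>)"
    by (rule set_lebesgue_integral_eq_integral(2)[OF kshift, symmetric])
  also have "a' = a + M * (LINT s:{0..\<tau>}|lebesgue. exp (\<omega> * s) * \<bar>k s\<bar> * \<phi> s)"
    unfolding a'_def set_lebesgue_integral_eq_integral(2)[OF G_abs, symmetric] G_def ..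
  finally have "w T * exp (- \<omega> * T) \<le>
      (a + M * (LINT s:{0..\<tau>}|lebesgue. exp (\<omega> * s) * \<bar>k s\<bar> * \<phi> s)) *
      exp (M * p * exp (\<omega> * \<tau>) * (LINT s:{0..T}|lebesgue. \<bar>k (s + \<tau>)\<bar>) + M * l * T) *
      exp (- \<omega> * T)"
    by (rule mult_right_mono) simp
  also have "w T * exp (- \<omega> * T) = y T"
    by (simp add: w_def exp_minus)
  finally show ?thesis .
qed

section \<open>Riesz representation, Hilbert space adjoints and the delay operator\<close>

text \<open>
  The representative is the minimiser of \<open>\<parallel>x\<parallel>\<^sup>2 - 2 \<phi>(x)\<close>; minimising sequences are Cauchy by
  the parallelogram law.
\<close>

lemma riesz_representation:
  fixes \<phi> :: "'a::{real_inner, banach} \<Rightarrow> real"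
  assumes "bounded_linear \<phi>"
  shows "\<exists>z. \<forall>x. \<phi> x = inner x z"
proof -
  interpret \<phi>: bounded_linear \<phi> by fact
  define J where "J x = (norm x)\<^sup>2 - 2 * \<phi> x" for x
  define \<epsilon> where "\<epsilon> n = 1 / real (Suc n)" for n
  define m where "m = Inf (range J)"
  obtain K where K: "\<And>x. norm (\<phi> x) \<le> norm x * K" using \<phi>.bounded by blast
  \<comment> \<open>Completing the square in \<open>norm x\<close> shows that \<open>J\<close> is
    bounded below, so its infimum \<open>m\<close> is meaningful.\<close>
  have "- (K\<^sup>2) \<le> J x" for x
  proof -
    have "0 \<le> (norm x - K)\<^sup>2" by simp
    then show ?thesis using K[of x] by (auto simp: J_def power2_diff abs_le_iff mult_ac)
  qed
  then have bdd: "bdd_below (range J)" by (intro bdd_belowI[of _ "- (K\<^sup>2)"]) auto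
  then have m_le: "m \<le> J x" for x unfolding m_def by (intro cInf_lower) auto
  have "\<exists>x. J x < m + \<epsilon> n" for n
    using cInf_lessD[of "range J" "m + \<epsilon> n"] by (auto simp: m_def \<epsilon>_def)
  then obtain X where X: "\<And>n. J (X n) < m + \<epsilon> n" by metis
  have par: "(norm (x - y))\<^sup>2 \<le> 2 * (J x - m) + 2 * (J y - m)" for x y
  proof -
    \<comment> \<open>The linear part of \<open>J\<close> is exact at the midpoint, so only the
      parallelogram defect \<open>(norm (x - y))\<^sup>2\<close> remains; \<open>J\<close> at the
      midpoint is at least \<open>m\<close>.\<close>
    have "4 * J ((1/2) *\<^sub>R (x + y)) = 2 * J x + 2 * J y - (norm (x - y))\<^sup>2"
      unfolding J_def power2_norm_eq_inner
      by (simp add: \<phi>.scaleR \<phi>.add inner_simps inner_commute algebra_simps)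
    with m_le[of "(1/2) *\<^sub>R (x + y)"] show ?thesis by simp
  qed
  have "Cauchy X"
  proof (rule CauchyI)
    fix e :: real assume e: "0 < e"
    \<comment> \<open>The factor 4 absorbs
      \<open>2 * \<epsilon> i + 2 * \<epsilon> j \<le> 4 * \<epsilon> N\<close>, which comes from
      \<open>par\<close>.\<close>
    then obtain N where N: "\<epsilon> N < e\<^sup>2 / 4"
      using nat_approx_posE[of "e\<^sup>2 / 4"] by (auto simp: \<epsilon>_def)
    have "norm (X i - X j) < e" if "N \<le> i" "N \<le> j" for i j
    proof -
      have "\<epsilon> i \<le> \<epsilon> N" "\<epsilon> j \<le> \<epsilon> N"
        using that by (auto simp: \<epsilon>_def intro!: divide_left_mono)
      moreover have "(norm (X i - X j))\<^sup>2 < 2 * \<epsilon> i + 2 * \<epsilon> j"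
        using par[of "X i" "X j"] X[of i] X[of j] by argo
      ultimately have "(norm (X i - X j))\<^sup>2 < e\<^sup>2"
        using N by argo
      then show ?thesis using e power2_less_imp_less by fastforce
    qed
    then show "\<exists>N. \<forall>i\<ge>N. \<forall>j\<ge>N. norm (X i - X j) < e" by blast
  qed
  then obtain z where z: "X \<longlonglongrightarrow> z" using Cauchy_convergent_iff convergent_def by blast
  have "(\<lambda>n. J (X n)) \<longlonglongrightarrow> J z"
    unfolding J_def by (intro tendsto_intros z \<phi>.tendsto)
  moreover have "(\<lambda>n. m + \<epsilon> n) \<longlonglongrightarrow> m + 0"
    unfolding \<epsilon>_def by (intro tendsto_intros LIMSEQ_Suc[OF lim_1_over_n])
  ultimately have Jz: "J z \<le> m"
    using X by (intro LIMSEQ_le[of "\<lambda>n. J (X n)" _ "\<lambda>n. m + \<epsilon> n"])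
      (auto intro: less_imp_le)
  have "\<phi> x = inner x z" for x
  proof (cases "x = 0")
    case False
    define d where "d = inner x z - \<phi> x"
    \<comment> \<open>This \<open>r\<close> minimises the quadratic
      \<open>r\<^sup>2 * inner x x + 2 * r * d\<close>. Its minimum is negative unless
      \<open>d = 0\<close>, which minimality of \<open>z\<close> enforces.\<close>
    define r where "r = - d / inner x x"
    have "0 \<le> J (z + r *\<^sub>R x) - J z" using Jz m_le[of "z + r *\<^sub>R x"] by linarith
    also have "\<dots> = r\<^sup>2 * inner x x + 2 * r * d"
      unfolding J_def d_def power2_norm_eq_inner
      by (simp add: \<phi>.scaleR \<phi>.add inner_simps power2_eq_square inner_commute algebra_simps)
    also have "\<dots> = - d\<^sup>2 / inner x x"
      using False by (simp add: r_def power2_eq_square field_simps)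
    finally have "d\<^sup>2 \<le> 0"
      using False inner_gt_zero_iff[of x] by (auto simp: divide_le_0_iff simp del: inner_gt_zero_iff)
    then show ?thesis by (simp add: d_def)
  qed simp
  then show ?thesis by blast
qed

text \<open>
  \<^const>\<open>adjoint\<close> is a \<open>SOME\<close> term, meaningful only once an adjoint is known to exist; the library
  provides this in finite dimension only.
\<close>

lemma inner_adjoint_blinfun:
  fixes B :: "'w::{real_inner, banach} \<Rightarrow>\<^sub>L 'h::real_inner"
  shows "inner x (adjoint (blinfun_apply B) y) = inner (B x) y"
proof -
  have "\<exists>z. \<forall>x. inner (B x) y = inner x z" for y
    by (rule riesz_representation
        [OF bounded_linear_compose[OF bounded_linear_inner_left blinfun.bounded_linear_right]])
  then have "\<exists>f'. \<forall>x y. inner (B x) y = inner x (f' y)" by metis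
  from someI_ex[OF this] have "\<forall>x y. inner (B x) y = inner x (adjoint (blinfun_apply B) y)"
    unfolding adjoint_def .
  then show ?thesis by metis
qed

text \<open>Vectors with the same inner product against every \<open>x\<close> coincide, and the
  adjoint identity is linear in \<open>y\<close>.\<close>

lemma linear_adjoint_blinfun:
  fixes B :: "'w::{real_inner, banach} \<Rightarrow>\<^sub>L 'h::real_inner"
  shows "linear (adjoint (blinfun_apply B))"
  by (rule linearI; rule vector_eq_ldot[THEN iffD1])
    (simp_all add: inner_adjoint_blinfun inner_add_right)

lemma norm_adjoint_blinfun_le:
  fixes B :: "'w::{real_inner, banach} \<Rightarrow>\<^sub>L 'h::real_inner"
  shows "norm (adjoint (blinfun_apply B) y) \<le> norm B * norm y"
proof (cases "adjoint (blinfun_apply B) y = 0")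
  case False
  let ?z = "adjoint (blinfun_apply B) y"
  \<comment> \<open>The adjoint identity is tested with \<open>?z\<close> itself; one factor
    \<open>norm ?z\<close> cancels at the end.\<close>
  have "norm ?z * norm ?z = inner (B ?z) y"
    by (metis inner_adjoint_blinfun power2_eq_square power2_norm_eq_inner)
  also have "\<dots> \<le> norm (B ?z) * norm y" by (rule norm_cauchy_schwarz)
  also have "\<dots> \<le> norm B * norm ?z * norm y"
    by (intro mult_right_mono norm_blinfun) auto
  finally have "norm ?z * norm ?z \<le> norm ?z * (norm B * norm y)" by (simp add: mult_ac)
  then show ?thesis using False by simp
qed simp

lemma linear_delay_operator:
  fixes B :: "'w::{real_inner, banach} \<Rightarrow>\<^sub>L 'h::real_inner"
  shows "linear (delay_operator B :: 'v::real_inner \<times> 'h \<Rightarrow> _)"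
  by (rule linearI) (auto simp: delay_operator_def blinfun.add_right blinfun.scaleR_right
      linear_add[OF linear_adjoint_blinfun] linear_scale[OF linear_adjoint_blinfun])

lemma norm_delay_operator_le:
  fixes B :: "'w::{real_inner, banach} \<Rightarrow>\<^sub>L 'h::real_inner"
    and X :: "'v::real_inner \<times> 'h"
  shows "norm (delay_operator B X) \<le> (norm B)\<^sup>2 * norm X"
proof -
  obtain u v where X: "X = (u, v)" by force
  have "norm (delay_operator B X) = norm (B (adjoint (blinfun_apply B) v))"
    by (simp add: X delay_operator_def norm_Pair)
  also have "\<dots> \<le> norm B * (norm B * norm v)"
    by (intro order_trans[OF norm_blinfun] mult_left_mono norm_adjoint_blinfun_le) auto
  also have "\<dots> \<le> norm B * (norm B * norm X)"
    using norm_snd_le[of v u] by (intro mult_left_mono) (auto simp: X)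
  finally show "norm (delay_operator B X) \<le> (norm B)\<^sup>2 * norm X"
    by (simp add: power2_eq_square mult_ac)
qed


section \<open>Growth and uniqueness estimates for mild solutions\<close>

text \<open>The forcing \<open>q\<close> is left abstract so that the estimate covers both a
  solution with its history and a difference of two solutions with zero data. Taking norms in
  Duhamel's formula reduces it to the scalar inequality with \<open>a = M * norm x\<close>.\<close>

lemma duhamel_decay:
  fixes S :: "real \<Rightarrow> 'a::{banach, second_countable_topology} \<Rightarrow>\<^sub>L 'a"
    and k \<phi> :: "real \<Rightarrow> real" and W q :: "real \<Rightarrow> 'a"
  assumes nonneg: "0 \<le> \<tau>" "0 \<le> M" "0 \<le> p" "0 \<le> l" "0 \<le> T"
    and S: "\<And>t. 0 \<le> t \<Longrightarrow> norm (S t) \<le> M * exp (- \<omega> * t)"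
    and k: "\<And>T. 0 \<le> T \<Longrightarrow> k absolutely_integrable_on {0..T}"
    and W: "continuous_on {0..} W"
    and \<phi>: "continuous_on {0..\<tau>} \<phi>" "\<And>s. s \<in> {0..\<tau>} \<Longrightarrow> 0 \<le> \<phi> s"
    and q_int: "\<And>t. 0 \<le> t \<Longrightarrow> t \<le> T \<Longrightarrow> set_integrable lebesgue {0..t} (\<lambda>s. S (t - s) (q s))"
    and duhamel: "\<And>t. 0 \<le> t \<Longrightarrow> t \<le> T \<Longrightarrow>
      W t = S t x + (LINT s:{0..t}|lebesgue. S (t - s) (q s))"
    and q: "\<And>s. 0 \<le> s \<Longrightarrow> s \<le> T \<Longrightarrow>
      norm (q s) \<le> \<bar>k s\<bar> * (if s \<le> \<tau> then \<phi> s else p * norm (W (s - \<tau>))) + l * norm (W s)"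
  shows "norm (W T) \<le>
      M * (norm x + (LINT s:{0..\<tau>}|lebesgue. exp (\<omega> * s) * \<bar>k s\<bar> * \<phi> s)) *
      exp (M * p * exp (\<omega> * \<tau>) * (LINT s:{0..T}|lebesgue. \<bar>k (s + \<tau>)\<bar>) + M * l * T) *
      exp (- \<omega> * T)"
proof -
  have "norm (W T) \<le> (M * norm x + M * (LINT s:{0..\<tau>}|lebesgue. exp (\<omega> * s) * \<bar>k s\<bar> * \<phi> s)) *
      exp (M * p * exp (\<omega> * \<tau>) * (LINT s:{0..T}|lebesgue. \<bar>k (s + \<tau>)\<bar>) + M * l * T) *
      exp (- \<omega> * T)"
  proof (intro delay_gronwall[where y = "\<lambda>t. norm (W t)"] nonneg k \<phi> continuous_on_norm W norm_ge_zero)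
    fix t assume t: "0 \<le> t" "t \<le> T"
    define g where "g s = norm (S (t - s) (q s))" for s
    have g_int: "g absolutely_integrable_on {0..t}"
      unfolding g_def by (rule set_integrable_norm[OF q_int[OF t]])
    have "norm (W t) \<le> norm (S t x) + norm (LINT s:{0..t}|lebesgue. S (t - s) (q s))"
      unfolding duhamel[OF t] by (rule norm_triangle_ineq)
    also have "norm (S t x) \<le> M * exp (- \<omega> * t) * norm x"
      by (intro order_trans[OF norm_blinfun] mult_right_mono S t) auto
    also have "norm (LINT s:{0..t}|lebesgue. S (t - s) (q s)) \<le> integral {0..t} g"
      using set_integral_norm_bound[OF q_int[OF t]] set_lebesgue_integral_eq_integral(2)[OF g_int]
      by (simp add: g_def)
    finally have "norm (W t) \<le> exp (- \<omega> * t) * (M * norm x) + integral {0..t} g"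
      by (simp add: mult_ac)
    moreover have "g s \<le> M * exp (- \<omega> * (t - s)) *
        (\<bar>k s\<bar> * (if s \<le> \<tau> then \<phi> s else p * norm (W (s - \<tau>))) + l * norm (W s))"
      if "s \<in> {0..t}" for s
      unfolding g_def using that t nonneg
      by (intro order_trans[OF norm_blinfun] mult_mono S q) auto
    ultimately show "\<exists>g. g integrable_on {0..t} \<and>
        norm (W t) \<le> exp (- \<omega> * t) * (M * norm x) + integral {0..t} g \<and>
        (\<forall>s\<in>{0..t}. g s \<le> M * exp (- \<omega> * (t - s)) *
          (\<bar>k s\<bar> * (if s \<le> \<tau> then \<phi> s else p * norm (W (s - \<tau>))) + l * norm (W s)))"
      using set_lebesgue_integral_eq_integral(1)[OF g_int] by blast
  qed
  then show ?thesis by (simp add: distrib_left)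
qed

text \<open>In the difference of two solutions the initial vector and the history cancel, so
  \<open>duhamel_decay\<close> applies with \<open>x = 0\<close> and \<open>\<phi> = 0\<close> and
  its right-hand side vanishes.\<close>

lemma mild_solution_unique:
  fixes S :: "real \<Rightarrow> 'a::{banach, second_countable_topology} \<Rightarrow>\<^sub>L 'a"
  assumes \<tau>: "0 \<le> \<tau>" and M: "0 \<le> M" and p: "0 \<le> p"
    and S: "\<And>t. 0 \<le> t \<Longrightarrow> norm (S t) \<le> M * exp (- \<omega> * t)"
    and k: "\<And>T. 0 \<le> T \<Longrightarrow> k absolutely_integrable_on {0..T}"
    and P: "linear P" "\<And>X. norm (P X) \<le> p * norm X"
    and F: "\<And>r. 0 < r \<Longrightarrow> 0 \<le> L r"
      "\<And>r X Y. 0 < r \<Longrightarrow> norm X \<le> r \<Longrightarrow> norm Y \<le> r \<Longrightarrow> norm (F X - F Y) \<le> L r * norm (X - Y)"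
    and U: "mild_solution S \<tau> k P F U0 f U" and V: "mild_solution S \<tau> k P F U0 f V"
    and T: "0 \<le> T"
  shows "U T = V T"
proof -
  have cont: "continuous_on {0..} U" "continuous_on {0..} V"
    using U V by (auto simp: mild_solution_def)
  \<comment> \<open>Compactness of \<open>{0..T}\<close> gives a radius depending on
    \<open>T\<close>, which suffices because \<open>duhamel_decay\<close> needs its bound on
    \<open>q\<close> only up to \<open>T\<close>.\<close>
  have "bounded (U ` {0..T} \<union> V ` {0..T})"
    by (intro bounded_Un[THEN iffD2] conjI compact_imp_bounded compact_continuous_image
        continuous_on_subset[OF cont(1)] continuous_on_subset[OF cont(2)]) auto
  then obtain r where r: "0 < r" "\<And>X. X \<in> U ` {0..T} \<union> V ` {0..T} \<Longrightarrow> norm X \<le> r"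
    unfolding bounded_pos by blast
  define W where "W t = U t - V t" for t
  define q where "q s = - (k s *\<^sub>R (if s \<le> \<tau> then 0 else P (W (s - \<tau>)))) + (F (U s) - F (V s))" for s
  have q: "S (t - s) (q s) = duhamel_integrand S \<tau> k P F f U t s - duhamel_integrand S \<tau> k P F f V t s" for t s
    unfolding duhamel_integrand_def blinfun.diff_right[symmetric]
    by (simp add: q_def W_def linear_diff[OF P(1)] algebra_simps)
  have "norm (W T) \<le>
      M * (norm (0 :: 'a) + (LINT s:{0..\<tau>}|lebesgue. exp (\<omega> * s) * \<bar>k s\<bar> * 0)) *
      exp (M * p * exp (\<omega> * \<tau>) * (LINT s:{0..T}|lebesgue. \<bar>k (s + \<tau>)\<bar>) + M * L r * T) *
      exp (- \<omega> * T)"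
  proof (rule duhamel_decay[where \<phi> = "\<lambda>_. 0" and x = 0 and q = q])
    show "continuous_on {0..} W"
      unfolding W_def by (intro continuous_intros cont)
    show "set_integrable lebesgue {0..t} (\<lambda>s. S (t - s) (q s))" if "0 \<le> t" for t
      unfolding q using U V that by (intro set_integral_diff(1)) (auto simp: mild_solution_def)
    show "W t = S t 0 + (LINT s:{0..t}|lebesgue. S (t - s) (q s))" if "0 \<le> t" for t
      unfolding q using U V that by (subst set_integral_diff(2)) (auto simp: mild_solution_def W_def)
    show "norm (q s) \<le> \<bar>k s\<bar> * (if s \<le> \<tau> then 0 else p * norm (W (s - \<tau>))) + L r * norm (W s)"
      if "0 \<le> s" "s \<le> T" for s
      unfolding q_def
    proof (intro norm_triangle_le add_mono)
      show "norm (F (U s) - F (V s)) \<le> L r * norm (W s)"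
        unfolding W_def using that by (intro F r) auto
      show "norm (- (k s *\<^sub>R (if s \<le> \<tau> then 0 else P (W (s - \<tau>)))))
          \<le> \<bar>k s\<bar> * (if s \<le> \<tau> then 0 else p * norm (W (s - \<tau>)))"
        using P(2) by (auto intro!: mult_left_mono)
    qed
  qed (use assms F(1)[OF r(1)] in auto)
  then show ?thesis by (simp add: W_def)
qed

section \<open>Exponential decay in the energy space\<close>

theorem theorem2p1:
  fixes DA :: "'h::{real_inner, banach, second_countable_topology} set"
    and A :: "'h \<Rightarrow> 'h"
    and DR :: "'h set" and R :: "'h \<Rightarrow> 'h"
    and \<iota> :: "'v::{real_inner, banach, second_countable_topology} \<Rightarrow> 'h"
    and C :: "'w1::{real_inner, banach} \<Rightarrow>\<^sub>L 'h"
    and B :: "'w2::{real_inner, banach} \<Rightarrow>\<^sub>L 'h"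
    and \<tau> K M \<omega> \<omega>' \<gamma> \<rho> C\<rho> :: real
    and k :: "real \<Rightarrow> real"
    and \<psi> :: "'v \<Rightarrow> real" and D\<psi> :: "'v \<Rightarrow> 'v \<Rightarrow> real" and grad\<psi> :: "'v \<Rightarrow> 'h"
    and c :: "'v \<Rightarrow> real" and L :: "real \<Rightarrow> real" and h :: "real \<Rightarrow> real"
    and S :: "real \<Rightarrow> ('v \<times> 'h) \<Rightarrow>\<^sub>L ('v \<times> 'h)"
  assumes A_selfadjoint: "self_adjoint_operator DA A"
    and A_positive: "positive_operator DA A"
    and A_compact_inverse: "compact_inverse DA A"
    and R_sqrt: "operator_sqrt DA A DR R"
    and energy: "sqrt_domain_space DR R \<iota>"
    and tau: "\<tau> > 0"
    and k_L1_loc: "\<forall>T\<ge>0. set_integrable lebesgue {0..T} k"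
    and K: "K > 0" "\<forall>t\<ge>0. (LINT s:{max 0 (t - \<tau>)..t}|lebesgue. \<bar>k s\<bar>) \<le> K"
    and gateaux: "\<forall>u. has_gateaux_derivative \<psi> (D\<psi> u) u"
    and H1: "\<forall>u. c u > 0 \<and> (\<forall>v. \<bar>D\<psi> u v\<bar> \<le> c u * norm (\<iota> v))"
    and grad: "\<forall>u v. inner (grad\<psi> u) (\<iota> v) = D\<psi> u v"
    and H2: "\<forall>r>0. L r > 0 \<and>
          (\<forall>u v. norm (R (\<iota> u)) \<le> r \<longrightarrow> norm (R (\<iota> v)) \<le> r \<longrightarrow>
             norm (grad\<psi> u - grad\<psi> v) \<le> L r * norm (R (\<iota> (u - v))))"
    and H3: "\<psi> 0 = 0" "grad\<psi> 0 = 0" "strict_mono_on {0..} h" "continuous_on {0..} h"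
          "\<forall>u. norm (grad\<psi> u) \<le> h (norm (R (\<iota> u))) * norm (R (\<iota> u))"
    and semigroup: "C0_semigroup S"
    and generator: "infinitesimal_generator (wave_domain DA \<iota>) (wave_operator A C \<iota>) S"
    and exp_stable: "M > 0" "\<omega> > 0" "\<forall>t\<ge>0. norm (S t) \<le> M * exp (- \<omega> * t)"
    and gamma: "\<gamma> \<ge> 0" and omega': "0 \<le> \<omega>'" "\<omega>' < \<omega>"
    and k_growth: "\<forall>t>0. M * (norm B)\<^sup>2 * exp (\<omega> * \<tau>) *
          (LINT s:{0..t}|lebesgue. \<bar>k (s + \<tau>)\<bar>) \<le> \<gamma> + \<omega>' * t"
    and rho: "\<rho> > 0" "C\<rho> > 0" "L C\<rho> < (\<omega> - \<omega>') / M"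
    and wellposed: "\<forall>U0 f. admissible_data \<tau> k \<rho> U0 f \<longrightarrow>
          (\<exists>U. mild_solution S \<tau> k (delay_operator B) (source_term grad\<psi>) U0 f U \<and>
               (\<forall>t>0. norm (U t) \<le> C\<rho>) \<and>
               (\<forall>V. mild_solution S \<tau> k (delay_operator B) (source_term grad\<psi>) U0 f V \<and>
                    (\<forall>t>0. norm (V t) \<le> C\<rho>) \<longrightarrow> (\<forall>t\<ge>0. V t = U t)))"
  shows "\<forall>U0 f U. admissible_data \<tau> k \<rho> U0 f \<longrightarrow>
          mild_solution S \<tau> k (delay_operator B) (source_term grad\<psi>) U0 f U \<longrightarrow>
          (\<forall>t\<ge>0. norm (U t) \<le>
             M * exp \<gamma> *
             (norm U0 + (LINT s:{0..\<tau>}|lebesgue. exp (\<omega> * s) * \<bar>k s\<bar> * norm (f (s - \<tau>)))) *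
             exp (- (\<omega> - \<omega>' - M * L C\<rho>) * t))"
proof (intro allI impI)
  fix U0 :: "'v \<times> 'h" and f U :: "real \<Rightarrow> 'v \<times> 'h" and t :: real
  assume adm: "admissible_data \<tau> k \<rho> U0 f"
    and U: "mild_solution S \<tau> k (delay_operator B) (source_term grad\<psi>) U0 f U"
    and t: "0 \<le> t"
  \<comment> \<open>This identifies the norm of \<open>'v\<close> with the energy norm in
    \<open>H2\<close>, turning \<open>H2\<close> into a local Lipschitz bound on the product
    space.\<close>
  have emb: "norm (R (\<iota> u)) = norm u" for u
    using energy by (simp add: sqrt_domain_space_def norm_eq_sqrt_inner)
  have lip: "norm (source_term grad\<psi> X - source_term grad\<psi> Y) \<le> L r * norm (X - Y)"
    if r: "0 < r" "norm X \<le> r" "norm Y \<le> r" for r and X Y :: "'v \<times> 'h"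
  proof -
    have "norm (fst X) \<le> r" "norm (fst Y) \<le> r"
      using r norm_fst_le[of "fst X" "snd X"] norm_fst_le[of "fst Y" "snd Y"] by auto
    then have "norm (grad\<psi> (fst X) - grad\<psi> (fst Y)) \<le> L r * norm (fst X - fst Y)"
      using H2 r(1) by (simp add: emb)
    also have "\<dots> \<le> L r * norm (X - Y)"
      using H2 r(1) norm_fst_le[of "fst (X - Y)" "snd (X - Y)"]
      by (intro mult_left_mono) (auto simp: minus_prod_def intro: less_imp_le)
    finally show ?thesis
      by (simp add: source_term_def case_prod_beta norm_Pair)
  qed
  have L_nonneg: "0 \<le> L r" if "0 < r" for r
    using H2 that by (auto intro: less_imp_le)
  have S: "norm (S t) \<le> M * exp (- \<omega> * t)" if "0 \<le> t" for t
    using exp_stable that by blast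
  have k: "k absolutely_integrable_on {0..T}" if "0 \<le> T" for T
    using k_L1_loc that by blast
  obtain V where V: "mild_solution S \<tau> k (delay_operator B) (source_term grad\<psi>) U0 f V"
    "\<And>s. 0 < s \<Longrightarrow> norm (V s) \<le> C\<rho>"
    using wellposed adm by blast
  have "U s = V s" if "0 \<le> s" for s
    by (rule mild_solution_unique[where p = "(norm B)\<^sup>2" and L = L, OF _ _ _ S k
          linear_delay_operator norm_delay_operator_le L_nonneg lip U V(1) that])
      (use tau exp_stable in auto)
  then have U_pos: "norm (U s) \<le> C\<rho>" if "0 < s" for s
    using V(2) that by auto
  have U_cont: "continuous_on {0..} U"
    using U by (simp add: mild_solution_def)
  \<comment> \<open>The well-posedness bound covers positive times only; right continuity extends it
    to 0, where the estimate of the forcing also uses it.\<close>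
  have "norm (U 0) \<le> C\<rho>"
  proof (rule tendsto_upperbound)
    have "(U \<longlongrightarrow> U 0) (at 0 within {0..})"
      using U_cont by (auto simp: continuous_on_def)
    then show "((\<lambda>s. norm (U s)) \<longlongrightarrow> norm (U 0)) (at_right 0)"
      by (intro tendsto_norm) (auto elim: tendsto_within_subset)
    show "eventually (\<lambda>s. norm (U s) \<le> C\<rho>) (at_right 0)"
      using eventually_at_right_less[of 0] by eventually_elim (rule U_pos)
  qed simp
  with U_pos have U_le: "norm (U s) \<le> C\<rho>" if "0 \<le> s" for s
    using that by (cases "s = 0") auto
  define I where "I = (LINT s:{0..\<tau>}|lebesgue. exp (\<omega> * s) * \<bar>k s\<bar> * norm (f (s - \<tau>)))"
  define J where "J = M * (norm B)\<^sup>2 * exp (\<omega> * \<tau>) * (LINT s:{0..t}|lebesgue. \<bar>k (s + \<tau>)\<bar>)"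
  have "norm (U t) \<le> M * (norm U0 + I) * exp (J + M * L C\<rho> * t) * exp (- \<omega> * t)"
    unfolding I_def J_def
  proof (rule duhamel_decay[where \<phi> = "\<lambda>s. norm (f (s - \<tau>))" and x = U0 and
        q = "\<lambda>s. - (k s *\<^sub>R (if s \<le> \<tau> then f (s - \<tau>) else delay_operator B (U (s - \<tau>))))
          + source_term grad\<psi> (U s)"])
    have "continuous_on {-\<tau>..0} f"
      using adm by (simp add: admissible_data_def)
    then have "continuous_on {0..\<tau>} (\<lambda>s. f (s - \<tau>))"
      by (rule continuous_on_compose2) (auto intro!: continuous_intros)
    then show "continuous_on {0..\<tau>} (\<lambda>s. norm (f (s - \<tau>)))"
      by (rule continuous_on_norm)
    fix s :: real assume s: "0 \<le> s"
    show "norm (- (k s *\<^sub>R (if s \<le> \<tau> then f (s - \<tau>) else delay_operator B (U (s - \<tau>))))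
          + source_term grad\<psi> (U s))
        \<le> \<bar>k s\<bar> * (if s \<le> \<tau> then norm (f (s - \<tau>)) else (norm B)\<^sup>2 * norm (U (s - \<tau>)))
          + L C\<rho> * norm (U s)"
    proof (intro norm_triangle_le add_mono)
      \<comment> \<open>Comparison with the zero state turns the Lipschitz bound on the ball of
        radius \<open>C\<rho>\<close> into a linear bound on the source.\<close>
      have "source_term grad\<psi> (0 :: 'v \<times> 'h) = 0"
        using H3(2) by (simp add: source_term_def zero_prod_def)
      then show "norm (source_term grad\<psi> (U s)) \<le> L C\<rho> * norm (U s)"
        using lip[OF rho(2) U_le[OF s], of 0] rho(2) by simp
    qed (auto intro!: mult_left_mono norm_delay_operator_le)
  qed (use U t tau exp_stable k L_nonneg[OF rho(2)] U_cont in
      \<open>auto simp: mild_solution_def duhamel_integrand_def[abs_def]\<close>)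
  also have "\<dots> = M * (norm U0 + I) * exp (J + M * L C\<rho> * t - \<omega> * t)"
    by (simp add: exp_diff exp_minus field_simps)
  also have "\<dots> \<le> M * (norm U0 + I) * exp (\<gamma> + \<omega>' * t + M * L C\<rho> * t - \<omega> * t)"
  proof (intro mult_left_mono)
    \<comment> \<open>The growth condition is stated for \<open>t > 0\<close>. At
      \<open>t = 0\<close> the integral is over a single point, so
      \<open>J = 0 \<le> \<gamma>\<close>.\<close>
    have "J \<le> \<gamma> + \<omega>' * t"
    proof (cases "t = 0")
      case True
      have "(\<lambda>s. \<bar>k (s + \<tau>)\<bar>) absolutely_integrable_on {0..0}"
        by (intro absolutely_integrable_onI) (auto intro: integrable_negligible)
      from set_lebesgue_integral_eq_integral(2)[OF this] have "J = 0"
        unfolding J_def True by simp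
      then show ?thesis using gamma True by simp
    qed (use k_growth t in \<open>simp add: J_def\<close>)
    then show "exp (J + M * L C\<rho> * t - \<omega> * t) \<le> exp (\<gamma> + \<omega>' * t + M * L C\<rho> * t - \<omega> * t)"
      by simp
    have "0 \<le> I"
      unfolding I_def set_lebesgue_integral_def by (intro Bochner_Integration.integral_nonneg) auto
    then show "0 \<le> M * (norm U0 + I)"
      using exp_stable by (intro mult_nonneg_nonneg) auto
  qed
  also have "\<dots> = M * exp \<gamma> * (norm U0 + I) * exp (- (\<omega> - \<omega>' - M * L C\<rho>) * t)"
    by (simp add: exp_add[symmetric] algebra_simps)
  finally show "norm (U t) \<le> M * exp \<gamma> *
      (norm U0 + (LINT s:{0..\<tau>}|lebesgue. exp (\<omega> * s) * \<bar>k s\<bar> * norm (f (s - \<tau>)))) *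
      exp (- (\<omega> - \<omega>' - M * L C\<rho>) * t)"
    unfolding I_def .
qed

end
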